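(* Let $V,W,W_p>0$ and $C_q,C_p$ be real numbers, and let $$\gamma_{AB}=\begin{pmatrix} V & 0 & C_q & 0\\ 0 & 1 & 0 & C_p\\ C_q & 0 & W & 0\\ 0 & C_p & 0 & W_p\end{pmatrix}.$$ Suppose that $\gamma_{AB}$ satisfies the uncertainty principle $\gamma_{AB}+i\Omega\succeq 0$. Put $$C_0=\frac{C_q}{VW-C_q^2},\qquad W_0=\frac{V}{VW-C_q^2}.$$ Then $$\left(C_p+C_0\right)^2\le\left(1-\frac{W}{V}W_0\right)\left(W_p-W_0\right),$$ that is, $C_p\in[C_p^-,C_p^+]$, where $$C_p^{\mp}=\mp\sqrt{\left(1-\frac{W}{V}W_0\right)\left(W_p-W_0\right)}-C_0.$$
   Context: The rows and columns of $\gamma_{AB}$ are ordered as $(\hat q_A,\hat p_A,\hat q_B,\hat p_B)$, and $\Omega=\begin{pmatrix}0&1\\-1&0\end{pmatrix}\oplus\begin{pmatrix}0&1\\-1&0\end{pmatrix}$. The condition $\gamma_{AB}+i\Omega\succeq0$ means that this Hermitian matrix is positive semidefinite. This condition forces $\gamma_{AB}$ to be positive definite, so $VW-C_q^2>0$ and $C_0,W_0$ are well defined. *)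

theory Defs
  imports "Jordan_Normal_Form.Schur_Decomposition"
begin

(* The order on complex is that of HOL-Library.Complex_Order: 0 \<le> z means that z is a
   nonnegative real number. Since \<bullet>c conjugates its second argument, (A *\<^sub>v v) \<bullet>c v is v\<^sup>* A v. *)
definition positive_semidefinite :: "complex mat \<Rightarrow> bool" where
  "positive_semidefinite A \<longleftrightarrow>
     square_mat A \<and> mat_adjoint A = A \<and>
     (\<forall>v \<in> carrier_vec (dim_row A). 0 \<le> (A *\<^sub>v v) \<bullet>c v)"

definition symplectic_block :: "complex mat" where
  "symplectic_block = mat_of_rows_list 2 [[0, 1], [-1, 0]]"

definition symplectic_form :: "complex mat" where
  "symplectic_form = diag_block_mat [symplectic_block, symplectic_block]"

(* Phase-space ordering (q_A, p_A, q_B, p_B). *)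
definition covariance_matrix :: "real \<Rightarrow> real \<Rightarrow> real \<Rightarrow> real \<Rightarrow> real \<Rightarrow> real mat" where
  "covariance_matrix V W Wp Cq Cp = mat_of_rows_list 4
     [[V,  0,  Cq, 0 ],
      [0,  1,  0,  Cp],
      [Cq, 0,  W,  0 ],
      [0,  Cp, 0,  Wp]]"

definition uncertainty_principle :: "real mat \<Rightarrow> bool" where
  "uncertainty_principle \<gamma> \<longleftrightarrow>
     positive_semidefinite (map_mat complex_of_real \<gamma> + \<i> \<cdot>\<^sub>m symplectic_form)"

end

(* Testing gamma + i Omega on vectors with real position entries x and purely imaginary
   momentum entries i y turns the uncertainty principle into the real inequality
   x^T P x + y^T Q y \<ge> 2 x^T y, where P and Q are the position and momentum blocks of gamma.
   Hence P is positive definite, and x = P^(-1) y shows that Q - P^(-1) is positive semidefinite.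
   The claim is the nonnegativity of its determinant. *)
theory Submission
  imports Defs
begin

text \<open>For nonzero \<open>a\<close>, the value at \<open>(-b, a)\<close> is \<open>a\<close>
  times the difference of the two sides. For \<open>a = 0\<close> the form is affine in
  \<open>x\<close> along \<open>y = 1\<close>, so a lower bound forces its slope to vanish.\<close>

lemma psd_binary_form_discriminant_le:
  fixes a b c :: real
  assumes nonneg: "\<And>x y. 0 \<le> a * x\<^sup>2 + 2 * b * x * y + c * y\<^sup>2"
  shows "b\<^sup>2 \<le> a * c"
proof (cases "a = 0")
  case True
  have "b = 0"
  proof (rule ccontr)
    assume "b \<noteq> 0"
    \<comment> \<open>The form takes the value -1 at this point.\<close>
    with nonneg [of "- (c + 1) / (2 * b)" 1] True show False
      by (simp add: field_simps)
  qed
  with True show ?thesis by simp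
next
  case False
  with nonneg [of 1 0] have "a > 0" by simp
  moreover have "0 \<le> a * (a * c - b\<^sup>2)"
    using nonneg [of "- b" a] by (simp add: algebra_simps power2_eq_square)
  ultimately show ?thesis by (simp add: zero_le_mult_iff)
qed

text \<open>The factor \<open>\<i>\<close> in the momentum entries of the test vector meets the one
  in front of the symplectic form, so its cross terms become real. The covariance matrix does not
  mix positions with momenta and contributes its two blocks separately.\<close>

lemma uncertainty_principle_real_form:
  assumes "uncertainty_principle (covariance_matrix V W Wp Cq Cp)"
  shows "0 \<le> V * x\<^sup>2 + 2 * Cq * x * z + W * z\<^sup>2 +
    (y\<^sup>2 + 2 * Cp * y * w + Wp * w\<^sup>2) - 2 * (x * y + z * w)"
proof -
  let ?A = "map_mat complex_of_real (covariance_matrix V W Wp Cq Cp) + \<i> \<cdot>\<^sub>m symplectic_form"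
  let ?B = "mat_of_rows_list 4
     [[of_real V, \<i>, of_real Cq, 0],
      [-\<i>, 1, 0, of_real Cp],
      [of_real Cq, 0, of_real W, \<i>],
      [0, of_real Cp, -\<i>, of_real Wp]]"
  let ?v = "vec_of_list [complex_of_real x, \<i> * of_real y, of_real z, \<i> * of_real w]"
  have lt4: "i = 0 \<or> i = 1 \<or> i = 2 \<or> i = 3" if "i < 4" for i :: nat
    using that by linarith
  have sum4: "(\<Sum>i = 0..<4. f i) = f 0 + f 1 + f 2 + f 3" for f :: "nat \<Rightarrow> complex"
    by (simp add: eval_nat_numeral)
  have A_eq: "?A = ?B"
  proof (rule eq_matI)
    fix i j
    assume "i < dim_row ?B" "j < dim_col ?B"
    then have "i < 4" "j < 4" by (simp_all add: mat_of_rows_list_def)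
    then show "?A $$ (i, j) = ?B $$ (i, j)"
      by (elim lt4 [THEN disjE] disjE)
        (simp_all add: covariance_matrix_def symplectic_form_def symplectic_block_def
          mat_of_rows_list_def Let_def)
  qed (simp_all add: covariance_matrix_def symplectic_form_def symplectic_block_def
      mat_of_rows_list_def)
  have "?v \<in> carrier_vec (dim_row ?B)"
    by (rule carrier_vecI) (simp add: mat_of_rows_list_def)
  moreover have "positive_semidefinite ?B"
    using assms unfolding uncertainty_principle_def A_eq .
  ultimately have "0 \<le> (?B *\<^sub>v ?v) \<bullet>c ?v"
    unfolding positive_semidefinite_def by blast
  also have "?B *\<^sub>v ?v = vec_of_list
    [of_real (V * x - y + Cq * z), \<i> * of_real (- x + y + Cp * w),
     of_real (Cq * x + W * z - w), \<i> * of_real (Cp * y - z + Wp * w)]"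
    (is "_ = ?u")
  proof (rule eq_vecI)
    fix i
    assume "i < dim_vec ?u"
    then have "i < 4" by simp
    then show "(?B *\<^sub>v ?v) $ i = ?u $ i"
      by (elim lt4 [THEN disjE] disjE)
        (simp_all add: mat_of_rows_list_def scalar_prod_def vec_of_list_index sum4
          algebra_simps del: vec_of_list_Cons)
  qed (simp add: mat_of_rows_list_def)
  also have "?u \<bullet>c ?v = of_real (V * x\<^sup>2 + 2 * Cq * x * z + W * z\<^sup>2 +
    (y\<^sup>2 + 2 * Cp * y * w + Wp * w\<^sup>2) - 2 * (x * y + z * w))"
    by (simp add: scalar_prod_def vec_of_list_index sum4 complex_eq_iff
        power2_eq_square algebra_simps del: vec_of_list_Cons)
  finally show ?thesis by (simp add: less_eq_complex_def)
qed

theorem mainTheorem2: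
  fixes V W Wp Cq Cp C0 W0 :: real
  assumes "V > 0" and "W > 0" and "Wp > 0"
    and "uncertainty_principle (covariance_matrix V W Wp Cq Cp)"
    and "C0 = Cq / (V * W - Cq\<^sup>2)"
    and "W0 = V / (V * W - Cq\<^sup>2)"
  shows "(Cp + C0)\<^sup>2 \<le> (1 - W / V * W0) * (Wp - W0) \<and>
         Cp \<in> {- sqrt ((1 - W / V * W0) * (Wp - W0)) - C0 ..
               sqrt ((1 - W / V * W0) * (Wp - W0)) - C0}"
proof -
  define D where "D = V * W - Cq\<^sup>2"
  note real_form = uncertainty_principle_real_form [OF assms(4)]
  have "D > 0"
  proof (rule ccontr)
    assume "\<not> D > 0"
    \<comment> \<open>The positions \<open>t * (-Cq, V)\<close> have position energy
      \<open>t\<^sup>2 * V * D\<close>, which is not positive here. Against the momenta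
      \<open>(0, 1)\<close>, this \<open>t\<close> makes the cross term \<open>2 * Wp\<close>, which
      exceeds the momentum energy \<open>Wp\<close>.\<close>
    define t where "t = Wp / V"
    have "0 \<le> t\<^sup>2 * V * D + Wp - 2 * (t * V)"
      using real_form [of "- Cq * t" "V * t" 0 1]
      by (simp add: D_def algebra_simps power2_eq_square)
    moreover have "t * V = Wp"
      using \<open>V > 0\<close> by (simp add: t_def)
    moreover have "t\<^sup>2 * V * D \<le> 0"
      using \<open>V > 0\<close> \<open>\<not> D > 0\<close> by (simp add: mult_nonneg_nonpos)
    ultimately show False using \<open>Wp > 0\<close> by simp
  qed
  have W0: "W0 = V / D" "W / V * (V / D) = W / D" and C0: "C0 = Cq / D"
    using \<open>V > 0\<close> assms(5,6) by (simp_all add: D_def)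
  \<comment> \<open>This is the quadratic form of Q - P^(-1): the inverse of P has diagonal entries
    \<open>W / D\<close> and \<open>V / D\<close>, the latter being \<open>W0\<close>, and
    off-diagonal entry \<open>- Cq / D\<close>, which is \<open>- C0\<close>.\<close>
  have "0 \<le> (1 - W / D) * y\<^sup>2 + 2 * (Cp + Cq / D) * y * w + (Wp - V / D) * w\<^sup>2" for y w
  proof -
    \<comment> \<open>By Cramer's rule \<open>(x, z)\<close> solves P \<open>(x, z)\<close> =
      \<open>(y, w)\<close>; it minimises the real form over positions for fixed momenta.\<close>
    define x where "x = (W * y - Cq * w) / D"
    define z where "z = (V * w - Cq * y) / D"
    have "V * x + Cq * z = (D * y) / D"
      unfolding x_def z_def by (simp add: D_def add_divide_distrib [symmetric]
        algebra_simps power2_eq_square)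
    moreover have "Cq * x + W * z = (D * w) / D"
      unfolding x_def z_def by (simp add: D_def add_divide_distrib [symmetric]
        algebra_simps power2_eq_square)
    ultimately have Pxz: "V * x + Cq * z = y" "Cq * x + W * z = w"
      using \<open>D > 0\<close> by simp_all
    have "V * x\<^sup>2 + 2 * Cq * x * z + W * z\<^sup>2 = x * (V * x + Cq * z) + z * (Cq * x + W * z)"
      by (simp add: algebra_simps power2_eq_square)
    \<comment> \<open>At this point the position energy equals \<open>x * y + z * w\<close>,
      cancelling half of the subtracted cross term.\<close>
    then have "0 \<le> y\<^sup>2 + 2 * Cp * y * w + Wp * w\<^sup>2 - (x * y + z * w)"
      using real_form [of x z y w] by (simp add: Pxz mult.commute)
    also have "x * y + z * w = (W * y\<^sup>2 - 2 * Cq * y * w + V * w\<^sup>2) / D"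
      unfolding x_def z_def using \<open>D > 0\<close> by (simp add: field_simps power2_eq_square)
    finally show ?thesis
      by (simp add: algebra_simps add_divide_distrib diff_divide_distrib)
  qed
  then have "(Cp + C0)\<^sup>2 \<le> (1 - W / V * W0) * (Wp - W0)"
    unfolding W0 C0 by (rule psd_binary_form_discriminant_le)
  \<comment> \<open>The radicand dominates a square, so the root is real and the two signs of
    \<open>Cp + C0\<close> give the two endpoints.\<close>
  moreover from this have "\<bar>Cp + C0\<bar> \<le> sqrt ((1 - W / V * W0) * (Wp - W0))"
    by (rule real_le_rsqrt [of "\<bar>Cp + C0\<bar>", simplified])
  ultimately show ?thesis by (auto simp: abs_le_iff)
qed

end
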